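(* Let $(M,\in)$ be a countable model of ZFA, and let $D$ be its double-edge graph: the graph with vertex set $M$ whose edges are all pairs $\{x,y\}$ (allowing $x=y$) such that $M\models x\in y$ and $M\models y\in x$. Then, for every finite connected loopy graph $\Gamma$, $D$ has infinitely many connected components isomorphic to $\Gamma$. Moreover, $D$ has at least one infinite connected component.
   Context: ZFA denotes the first-order theory obtained from ZFC (all objects being sets) by deleting the Axiom of Foundation and replacing it by the Anti-Foundation Axiom AFA. AFA states that every flat system of equations has a unique solution. A flat system of equations consists of a set $X$ of indeterminates, a set $A$ of sets called atoms (disjoint from $X$), and, for each $x\in X$, an equation $x=S_x$ with $S_x\subseteq X\cup A$ (the family $(S_x)_{x\in X}$ being itself a set). A solution is an assignment of sets to the indeterminates making all equations true, i.e. a function $s$ with domain $X$ such that $s(x)=\{s(y):y\in S_x\cap X\}\cup(S_x\cap A)$ for all $x\in X$. A loopy graph is an undirected graph without multiple edges in which loops are allowed, i.e. a set with a symmetric (not necessarily irreflexive) binary adjacency relation. Connected graphs are taken to be nonempty. Connected components are regarded as loopy graphs with the induced adjacency relation (loops included), and isomorphisms preserve and reflect both edges and loops. *)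

theory Defs
  imports Main "HOL-Library.Countable_Set"
begin

section \<open>First-order formulas of set theory\<close>

datatype fm =
    Mem nat nat
  | Equal nat nat
  | Neg fm
  | Conj fm fm
  | Forall nat fm

primrec sat :: "'a set \<Rightarrow> ('a \<Rightarrow> 'a \<Rightarrow> bool) \<Rightarrow> (nat \<Rightarrow> 'a) \<Rightarrow> fm \<Rightarrow> bool" where
  "sat M E v (Mem i j) \<longleftrightarrow> E (v i) (v j)"
| "sat M E v (Equal i j) \<longleftrightarrow> v i = v j"
| "sat M E v (Neg p) \<longleftrightarrow> \<not> sat M E v p"
| "sat M E v (Conj p q) \<longleftrightarrow> sat M E v p \<and> sat M E v q"
| "sat M E v (Forall i p) \<longleftrightarrow> (\<forall>a\<in>M. sat M E (v(i := a)) p)"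


section \<open>Models of ZFA\<close>

text \<open>
  A structure for the language of set theory has universe \<open>M\<close> and membership relation \<open>\<epsilon>\<close>.
  The predicates below are the Tarskian interpretations in this structure of the usual
  set-theoretic formulas: all quantifiers range over \<open>M\<close>.
\<close>

locale set_structure =
  fixes M :: "'a set" and mem :: "'a \<Rightarrow> 'a \<Rightarrow> bool" (infix "\<epsilon>" 50)
begin

definition is_empty :: "'a \<Rightarrow> bool" where
  "is_empty x \<longleftrightarrow> (\<forall>u\<in>M. \<not> u \<epsilon> x)"

definition subset_of :: "'a \<Rightarrow> 'a \<Rightarrow> bool" where
  "subset_of x y \<longleftrightarrow> (\<forall>u\<in>M. u \<epsilon> x \<longrightarrow> u \<epsilon> y)"

definition disjoint_sets :: "'a \<Rightarrow> 'a \<Rightarrow> bool" where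
  "disjoint_sets x y \<longleftrightarrow> \<not> (\<exists>u\<in>M. u \<epsilon> x \<and> u \<epsilon> y)"

text \<open>\<open>z = x \<union> {x}\<close>\<close>

definition is_successor :: "'a \<Rightarrow> 'a \<Rightarrow> bool" where
  "is_successor z x \<longleftrightarrow> (\<forall>u\<in>M. u \<epsilon> z \<longleftrightarrow> u \<epsilon> x \<or> u = x)"

text \<open>\<open>z = {x, y}\<close>, and the Kuratowski pair \<open>p = {{x}, {x, y}}\<close>\<close>

definition is_upair :: "'a \<Rightarrow> 'a \<Rightarrow> 'a \<Rightarrow> bool" where
  "is_upair z x y \<longleftrightarrow> (\<forall>u\<in>M. u \<epsilon> z \<longleftrightarrow> u = x \<or> u = y)"

definition is_opair :: "'a \<Rightarrow> 'a \<Rightarrow> 'a \<Rightarrow> bool" where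
  "is_opair p x y \<longleftrightarrow> (\<exists>a\<in>M. \<exists>b\<in>M. is_upair a x x \<and> is_upair b x y \<and> is_upair p a b)"

text \<open>\<open>(x, y) \<in> f\<close>\<close>

definition maps_to :: "'a \<Rightarrow> 'a \<Rightarrow> 'a \<Rightarrow> bool" where
  "maps_to f x y \<longleftrightarrow> (\<exists>p\<in>M. p \<epsilon> f \<and> is_opair p x y)"

definition is_function_on :: "'a \<Rightarrow> 'a \<Rightarrow> bool" where
  "is_function_on f X \<longleftrightarrow>
     (\<forall>p\<in>M. p \<epsilon> f \<longrightarrow> (\<exists>x\<in>M. \<exists>y\<in>M. x \<epsilon> X \<and> is_opair p x y)) \<and>
     (\<forall>x\<in>M. x \<epsilon> X \<longrightarrow> (\<exists>!y\<in>M. maps_to f x y))"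

text \<open>
  In a flat system the family \<open>(S\<^sub>x)\<close> of right-hand sides is an element \<open>S\<close> of the structure,
  namely a function with domain \<open>X\<close> in the sense of the structure.
\<close>

definition flat_system :: "'a \<Rightarrow> 'a \<Rightarrow> 'a \<Rightarrow> bool" where
  "flat_system X A S \<longleftrightarrow>
     disjoint_sets X A \<and> is_function_on S X \<and>
     (\<forall>x\<in>M. \<forall>r\<in>M. x \<epsilon> X \<and> maps_to S x r \<longrightarrow> (\<forall>u\<in>M. u \<epsilon> r \<longrightarrow> u \<epsilon> X \<or> u \<epsilon> A))"

text \<open>In the last clause, \<open>r = S\<^sub>x\<close> and \<open>t = s(x)\<close>.\<close>

definition flat_solution :: "'a \<Rightarrow> 'a \<Rightarrow> 'a \<Rightarrow> 'a \<Rightarrow> bool" where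
  "flat_solution X A S s \<longleftrightarrow>
     is_function_on s X \<and>
     (\<forall>x\<in>M. \<forall>r\<in>M. \<forall>t\<in>M. x \<epsilon> X \<and> maps_to S x r \<and> maps_to s x t \<longrightarrow>
        (\<forall>z\<in>M. z \<epsilon> t \<longleftrightarrow>
           (\<exists>y\<in>M. y \<epsilon> r \<and> y \<epsilon> X \<and> maps_to s y z) \<or> (z \<epsilon> r \<and> z \<epsilon> A)))"

end

text \<open>
  In the two schemas, the formula \<open>\<phi>\<close> may use as parameters the values \<open>v i\<close> of its other
  free variables; variable \<open>0\<close> is the argument and, in Replacement, variable \<open>1\<close> the value.
\<close>

locale zfa_model = set_structure M mem
  for M :: "'a set" and mem :: "'a \<Rightarrow> 'a \<Rightarrow> bool" (infix "\<epsilon>" 50) +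
  assumes extensionality:
      "\<forall>x\<in>M. \<forall>y\<in>M. (\<forall>u\<in>M. u \<epsilon> x \<longleftrightarrow> u \<epsilon> y) \<longrightarrow> x = y"
    and pairing:
      "\<forall>x\<in>M. \<forall>y\<in>M. \<exists>z\<in>M. is_upair z x y"
    and union:
      "\<forall>x\<in>M. \<exists>z\<in>M. \<forall>u\<in>M. u \<epsilon> z \<longleftrightarrow> (\<exists>y\<in>M. y \<epsilon> x \<and> u \<epsilon> y)"
    and powerset:
      "\<forall>x\<in>M. \<exists>z\<in>M. \<forall>u\<in>M. u \<epsilon> z \<longleftrightarrow> subset_of u x"
    and infinity:
      "\<exists>w\<in>M. (\<exists>e\<in>M. is_empty e \<and> e \<epsilon> w) \<and>
              (\<forall>x\<in>M. x \<epsilon> w \<longrightarrow> (\<exists>y\<in>M. is_successor y x \<and> y \<epsilon> w))"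
    and separation:
      "\<forall>\<phi> v. range v \<subseteq> M \<longrightarrow>
         (\<forall>x\<in>M. \<exists>z\<in>M. \<forall>u\<in>M. u \<epsilon> z \<longleftrightarrow> u \<epsilon> x \<and> sat M (\<epsilon>) (v(0 := u)) \<phi>)"
    and replacement:
      "\<forall>\<phi> v. range v \<subseteq> M \<longrightarrow>
         (\<forall>x\<in>M.
            (\<forall>u\<in>M. u \<epsilon> x \<longrightarrow>
               (\<forall>y\<in>M. \<forall>y'\<in>M. sat M (\<epsilon>) (v(0 := u, 1 := y)) \<phi> \<and>
                                sat M (\<epsilon>) (v(0 := u, 1 := y')) \<phi> \<longrightarrow> y = y')) \<longrightarrow>
            (\<exists>z\<in>M. \<forall>y\<in>M. y \<epsilon> z \<longleftrightarrow>
               (\<exists>u\<in>M. u \<epsilon> x \<and> sat M (\<epsilon>) (v(0 := u, 1 := y)) \<phi>)))"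
    and choice:
      "\<forall>x\<in>M.
         (\<forall>y\<in>M. y \<epsilon> x \<longrightarrow> \<not> is_empty y) \<and>
         (\<forall>y\<in>M. \<forall>y'\<in>M. y \<epsilon> x \<and> y' \<epsilon> x \<and> y \<noteq> y' \<longrightarrow> disjoint_sets y y') \<longrightarrow>
         (\<exists>c\<in>M. \<forall>y\<in>M. y \<epsilon> x \<longrightarrow> (\<exists>!u\<in>M. u \<epsilon> y \<and> u \<epsilon> c))"
    and anti_foundation:
      "\<forall>X\<in>M. \<forall>A\<in>M. \<forall>S\<in>M. flat_system X A S \<longrightarrow> (\<exists>!s\<in>M. flat_solution X A S s)"


section \<open>Loopy graphs\<close>

definition loopy_graph :: "'v set \<Rightarrow> 'v rel \<Rightarrow> bool" where
  "loopy_graph V R \<longleftrightarrow> R \<subseteq> V \<times> V \<and> sym R"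

definition connected_graph :: "'v set \<Rightarrow> 'v rel \<Rightarrow> bool" where
  "connected_graph V R \<longleftrightarrow> V \<noteq> {} \<and> (\<forall>x\<in>V. \<forall>y\<in>V. (x, y) \<in> R\<^sup>*)"

text \<open>Vertex sets of the connected components of \<open>(V, R)\<close>, for \<open>R \<subseteq> V \<times> V\<close> symmetric\<close>

definition components :: "'v set \<Rightarrow> 'v rel \<Rightarrow> 'v set set" where
  "components V R = V // Restr (R\<^sup>*) V"

definition graph_isomorphic :: "'v set \<Rightarrow> 'v rel \<Rightarrow> 'w set \<Rightarrow> 'w rel \<Rightarrow> bool" where
  "graph_isomorphic V R W S \<longleftrightarrow>
     (\<exists>f. bij_betw f V W \<and> (\<forall>x\<in>V. \<forall>y\<in>V. (x, y) \<in> R \<longleftrightarrow> (f x, f y) \<in> S))"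

definition double_edges :: "'a set \<Rightarrow> ('a \<Rightarrow> 'a \<Rightarrow> bool) \<Rightarrow> 'a rel" where
  "double_edges M E = {(x, y). x \<in> M \<and> y \<in> M \<and> E x y \<and> E y x}"

end

theory Submission imports Defs begin

text \<open>
  Double edges are 2-cycles of membership, so they never meet the well-founded part of the model.
  By AFA, the system \<open>\<sigma> i = {\<sigma> j | j adjacent to i} \<union> {b\<^sub>i}\<close> over the vertices of a
  finite graph without isolated vertices has a solution; if the \<open>b\<^sub>i\<close> are distinct
  well-founded sets, then the \<open>\<sigma> i\<close> are ill-founded, \<open>b\<^sub>i\<close> is the only well-founded
  element of \<open>\<sigma> i\<close>, and so the \<open>\<sigma> i\<close> are distinct and form a component isomorphic to the graph.
  Varying the \<open>b\<^sub>i\<close> among the numerals gives infinitely many components; the graph with one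
  vertex and no loop is realised by the numerals themselves.  The star \<open>c = {l\<^sub>u | u \<in> w}\<close>,
  \<open>l\<^sub>u = {c, u}\<close> over a set \<open>w\<close> containing the numerals yields an infinite component.
\<close>

section \<open>Sets of the model and their extensions\<close>

context set_structure
begin

definition ext :: "'a \<Rightarrow> 'a set" where
  "ext x = {u \<in> M. u \<epsilon> x}"

text \<open>Meaningful only when \<open>B\<close> is the extension of an element of
  \<open>M\<close>; otherwise the value is arbitrary. Lying in the image of \<open>M\<close> under
  \<open>ext\<close> therefore serves as the statement that an external set is a set of the
  model.\<close>

definition code :: "'a set \<Rightarrow> 'a" where
  "code B = inv_into M ext B"

definition opair :: "'a \<Rightarrow> 'a \<Rightarrow> 'a" where
  "opair x y = code {code {x, x}, code {x, y}}"

lemma ext_subset: "ext x \<subseteq> M"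
  by (auto simp: ext_def)

lemma mem_ext_iff: "u \<in> M \<Longrightarrow> u \<in> ext x \<longleftrightarrow> u \<epsilon> x"
  by (simp add: ext_def)

lemma code_mem [simp]: "B \<in> ext ` M \<Longrightarrow> code B \<in> M"
  and ext_code [simp]: "B \<in> ext ` M \<Longrightarrow> ext (code B) = B"
  unfolding code_def by (rule inv_into_into, assumption) (rule f_inv_into_f)

end

context zfa_model
begin

lemma ext_inject: "x \<in> M \<Longrightarrow> y \<in> M \<Longrightarrow> ext x = ext y \<Longrightarrow> x = y"
  using extensionality by (auto simp: ext_def set_eq_iff)

lemma ext_eq_iff: "x \<in> M \<Longrightarrow> B \<in> ext ` M \<Longrightarrow> ext x = B \<longleftrightarrow> x = code B"
  using ext_inject ext_code code_mem by metis

lemma empty_in_ext: "{} \<in> ext ` M"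
proof -
  obtain e where "e \<in> M" "is_empty e" using infinity by blast
  then have "ext e = {}" by (auto simp: is_empty_def ext_def)
  with \<open>e \<in> M\<close> show ?thesis by blast
qed

lemma pair_in_ext:
  assumes "x \<in> M" "y \<in> M" shows "{x, y} \<in> ext ` M"
proof -
  obtain z where "z \<in> M" "is_upair z x y" using pairing assms by blast
  then have "ext z = {x, y}" using assms by (auto simp: is_upair_def ext_def)
  with \<open>z \<in> M\<close> show ?thesis by blast
qed

lemma Union_in_ext:
  assumes "x \<in> M" shows "(\<Union>y\<in>ext x. ext y) \<in> ext ` M"
proof -
  obtain z where z: "z \<in> M" "\<forall>u\<in>M. u \<epsilon> z \<longleftrightarrow> (\<exists>y\<in>M. y \<epsilon> x \<and> u \<epsilon> y)"
    using union assms by blast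
  then have "ext z = (\<Union>y\<in>ext x. ext y)" by (auto simp: ext_def)
  with z show ?thesis by blast
qed

lemma Un_in_ext:
  assumes "B \<in> ext ` M" "C \<in> ext ` M" shows "B \<union> C \<in> ext ` M"
proof -
  obtain x y where xy: "x \<in> M" "y \<in> M" "B = ext x" "C = ext y" using assms by blast
  then obtain p where p: "p \<in> M" "ext p = {x, y}" using pair_in_ext by (metis imageE)
  show ?thesis using Union_in_ext[OF p(1)] xy p by simp
qed

lemma insert_in_ext:
  assumes "x \<in> M" "B \<in> ext ` M" shows "insert x B \<in> ext ` M"
  using Un_in_ext[OF pair_in_ext[OF assms(1) assms(1)] assms(2)] by simp

lemma finite_in_ext: "finite B \<Longrightarrow> B \<subseteq> M \<Longrightarrow> B \<in> ext ` M"
  by (induction rule: finite_induct) (auto simp: empty_in_ext intro!: insert_in_ext)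

text \<open>Russell's argument: the set of those elements of \<open>x\<close> that do not contain
  themselves cannot belong to \<open>x\<close>. Without Foundation \<open>x\<close> itself may be an
  element of \<open>x\<close>, so it is no witness.\<close>

lemma ex_not_in_ext:
  assumes "x \<in> M" shows "\<exists>y\<in>M. y \<notin> ext x"
proof -
  obtain z where z: "z \<in> M"
    "\<forall>u\<in>M. u \<epsilon> z \<longleftrightarrow> u \<epsilon> x \<and> sat M (\<epsilon>) ((\<lambda>_. x)(0 := u)) (Neg (Mem 0 0))"
    using separation[rule_format, of "\<lambda>_. x" x "Neg (Mem 0 0)"] assms by auto
  then show ?thesis by (auto simp: ext_def)
qed

section \<open>Kuratowski pairs and functions of the model\<close>

lemma is_upair_iff: "z \<in> M \<Longrightarrow> x \<in> M \<Longrightarrow> y \<in> M \<Longrightarrow> is_upair z x y \<longleftrightarrow> z = code {x, y}"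
  unfolding ext_eq_iff[OF _ pair_in_ext, symmetric] by (auto simp: is_upair_def ext_def)

lemma code_pair_mem [simp]: "x \<in> M \<Longrightarrow> y \<in> M \<Longrightarrow> code {x, y} \<in> M"
  by (simp add: pair_in_ext)

lemma opair_mem [simp]: "x \<in> M \<Longrightarrow> y \<in> M \<Longrightarrow> opair x y \<in> M"
  unfolding opair_def by (intro code_pair_mem)

lemma is_opair_iff:
  assumes "p \<in> M" "x \<in> M" "y \<in> M" shows "is_opair p x y \<longleftrightarrow> p = opair x y"
  \<comment> \<open>The rule \<open>insert_absorb2\<close> would shrink \<open>{x, x}\<close> to
    \<open>{x}\<close>, a form that \<open>is_upair_iff\<close> and \<open>code_pair_mem\<close> do
    not match.\<close>
  using assms by (auto simp: is_opair_def opair_def is_upair_iff simp del: insert_absorb2)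

lemma code_pair_eq_iff:
  assumes "x \<in> M" "y \<in> M" "x' \<in> M" "y' \<in> M"
  shows "code {x, y} = code {x', y'} \<longleftrightarrow> {x, y} = {x', y'}"
  using assms by (metis ext_code pair_in_ext)

lemma opair_eq_iff:
  assumes "x \<in> M" "y \<in> M" "x' \<in> M" "y' \<in> M"
  shows "opair x y = opair x' y' \<longleftrightarrow> x = x' \<and> y = y'"
  using assms unfolding opair_def
  by (simp add: code_pair_eq_iff doubleton_eq_iff del: insert_absorb2) blast

lemma maps_to_iff:
  assumes "x \<in> M" "y \<in> M" shows "maps_to f x y \<longleftrightarrow> opair x y \<in> ext f"
  using assms by (auto simp: maps_to_def is_opair_iff ext_def)

lemma maps_to_graph:
  assumes "ext f = (\<lambda>x. opair x (F x)) ` ext X" "F ` ext X \<subseteq> M" "x \<in> ext X" "y \<in> M"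
  shows "maps_to f x y \<longleftrightarrow> y = F x"
proof -
  have "x \<in> M" using assms(3) ext_subset by blast
  moreover have "opair x y \<in> ext f \<longleftrightarrow> (\<exists>x'\<in>ext X. x = x' \<and> y = F x')"
    unfolding assms(1) image_iff
    using assms(2,4) \<open>x \<in> M\<close> ext_subset[of X]
    by (intro bex_cong refl opair_eq_iff) auto
  ultimately show ?thesis using assms(3,4) by (auto simp: maps_to_iff)
qed

lemma is_function_on_graph:
  assumes "ext f = (\<lambda>x. opair x (F x)) ` ext X" "F ` ext X \<subseteq> M"
  shows "is_function_on f X"
  unfolding is_function_on_def
proof (intro conjI ballI impI)
  fix p assume "p \<in> M" "p \<epsilon> f"
  then have "p \<in> ext f" by (simp add: ext_def)
  then obtain x where x: "x \<in> ext X" "p = opair x (F x)" using assms(1) by blast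
  then have "x \<in> M" "x \<epsilon> X" "F x \<in> M" using assms(2) by (auto simp: ext_def)
  with x \<open>p \<in> M\<close> show "\<exists>x\<in>M. \<exists>y\<in>M. x \<epsilon> X \<and> is_opair p x y"
    by (auto simp: is_opair_iff)
next
  fix x assume "x \<in> M" "x \<epsilon> X"
  then have "x \<in> ext X" by (simp add: ext_def)
  then show "\<exists>!y\<in>M. maps_to f x y" using maps_to_graph[OF assms] assms(2) by blast
qed


section \<open>Solving flat systems indexed by an external set\<close>

text \<open>AFA in external terms: \<open>x i\<close> is the indeterminate with index
  \<open>i\<close>, \<open>r i\<close> its right-hand side, \<open>J i\<close> and
  \<open>B i\<close> the indices and the atoms occurring there. AFA speaks only of systems inside
  the model, so the indeterminates, the atoms and the graph of the system must all be coded.\<close>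

lemma flat_system_solution:
  fixes x r :: "'i \<Rightarrow> 'a"
  assumes X: "x ` I \<in> ext ` M" and A: "A \<in> ext ` M"
    and S: "(\<lambda>i. opair (x i) (r i)) ` I \<in> ext ` M"
    and inj: "inj_on x I" and disj: "x ` I \<inter> A = {}"
    and r: "\<And>i. i \<in> I \<Longrightarrow> r i \<in> M" "\<And>i. i \<in> I \<Longrightarrow> ext (r i) = x ` J i \<union> B i"
    and J: "\<And>i. i \<in> I \<Longrightarrow> J i \<subseteq> I" and B: "\<And>i. i \<in> I \<Longrightarrow> B i \<subseteq> A"
  shows "\<exists>\<sigma>. \<forall>i\<in>I. \<sigma> i \<in> M \<and> ext (\<sigma> i) = \<sigma> ` J i \<union> B i"
proof -
  define X' A' S' where "X' = code (x ` I)" and "A' = code A"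
    and "S' = code ((\<lambda>i. opair (x i) (r i)) ` I)"
  have M: "X' \<in> M" "A' \<in> M" "S' \<in> M" and eX: "ext X' = x ` I" and eA: "ext A' = A"
    and eS: "ext S' = (\<lambda>i. opair (x i) (r i)) ` I"
    using X A S by (simp_all add: X'_def A'_def S'_def)
  \<comment> \<open>The model sees indeterminates, not indices; injectivity of \<open>x\<close>
    turns \<open>r\<close> into a function of the indeterminate.\<close>
  define F where "F = (\<lambda>y. r (inv_into I x y))"
  have F: "F (x i) = r i" if "i \<in> I" for i using that inj by (simp add: F_def)
  have gS: "ext S' = (\<lambda>y. opair y (F y)) ` ext X'"
    unfolding eS eX image_image using F by (intro image_cong) auto
  have FM: "F ` ext X' \<subseteq> M" using F r eX by auto
  have xM: "x i \<in> M" if "i \<in> I" for i using that eX ext_subset by blast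
  have memX: "u \<epsilon> X' \<longleftrightarrow> u \<in> x ` I" and memA: "u \<epsilon> A' \<longleftrightarrow> u \<in> A" if "u \<in> M" for u
    using that eX eA mem_ext_iff by auto
  have mapsS: "maps_to S' (x i) q \<longleftrightarrow> q = r i" if "i \<in> I" "q \<in> M" for i q
    using maps_to_graph[OF gS FM, of "x i" q] that F eX by simp
  have memr: "u \<epsilon> r i \<longleftrightarrow> u \<in> x ` J i \<union> B i" if "i \<in> I" "u \<in> M" for u i
    using that r(2) mem_ext_iff by blast
  have "flat_system X' A' S'"
    unfolding flat_system_def
  proof (intro conjI ballI impI)
    show "disjoint_sets X' A'" using disj by (auto simp: disjoint_sets_def memX memA)
    show "is_function_on S' X'" using is_function_on_graph[OF gS FM] .
    fix y q u assume "y \<in> M" "q \<in> M" "y \<epsilon> X' \<and> maps_to S' y q" "u \<in> M" "u \<epsilon> q"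
    then obtain i where "i \<in> I" "q = r i" using memX mapsS by blast
    then show "u \<epsilon> X' \<or> u \<epsilon> A'"
      using \<open>u \<in> M\<close> \<open>u \<epsilon> q\<close> J B memr memX memA by blast
  qed
  then obtain s where s: "s \<in> M" "flat_solution X' A' S' s"
    using anti_foundation M by blast
  then have s_fun: "is_function_on s X'" by (simp add: flat_solution_def)
  have sol: "z \<epsilon> u \<longleftrightarrow> (\<exists>y\<in>M. y \<epsilon> q \<and> y \<epsilon> X' \<and> maps_to s y z) \<or> (z \<epsilon> q \<and> z \<epsilon> A')"
    if "y \<in> M" "q \<in> M" "u \<in> M" "y \<epsilon> X'" "maps_to S' y q" "maps_to s y u" "z \<in> M" for y q u z
    using s(2)[unfolded flat_solution_def, THEN conjunct2, rule_format, of y q u z] that by blast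
  define \<sigma> where "\<sigma> = (\<lambda>i. THE y. y \<in> M \<and> maps_to s (x i) y)"
  have ex1: "\<exists>!y. y \<in> M \<and> maps_to s (x i) y" if "i \<in> I" for i
    using s_fun[unfolded is_function_on_def, THEN conjunct2, rule_format, of "x i"] xM memX that
    by simp
  have \<sigma>M: "\<sigma> i \<in> M" if "i \<in> I" for i
    using theI'[OF ex1[OF that]] by (simp add: \<sigma>_def)
  have \<sigma>: "maps_to s (x i) y \<longleftrightarrow> y = \<sigma> i" if "i \<in> I" "y \<in> M" for i y
    using theI'[OF ex1[OF that(1)]] ex1[OF that(1)] that(2) by (auto simp: \<sigma>_def)
  have "ext (\<sigma> i) = \<sigma> ` J i \<union> B i" if i: "i \<in> I" for i
  proof -
    have BM: "B i \<subseteq> M" using B[OF i] eA ext_subset by blast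
    \<comment> \<open>Since atoms and indeterminates are disjoint, intersecting the right-hand side
      with either kind recovers \<open>J i\<close> or \<open>B i\<close>.\<close>
    have JB: "(x ` J i \<union> B i) \<inter> x ` I = x ` J i" using J[OF i] B[OF i] disj by blast
    have "z \<epsilon> \<sigma> i \<longleftrightarrow> z \<in> \<sigma> ` J i \<union> B i" if z: "z \<in> M" for z
    proof -
      have "z \<epsilon> \<sigma> i \<longleftrightarrow>
          (\<exists>y\<in>M. y \<epsilon> r i \<and> y \<epsilon> X' \<and> maps_to s y z) \<or> (z \<epsilon> r i \<and> z \<epsilon> A')"
        using i z xM r(1) \<sigma>M by (intro sol[of "x i"]) (simp_all add: \<sigma> mapsS memX)
      also have "(\<exists>y\<in>M. y \<epsilon> r i \<and> y \<epsilon> X' \<and> maps_to s y z) \<longleftrightarrow>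
          (\<exists>y\<in>(x ` J i \<union> B i) \<inter> x ` I. maps_to s y z)"
        using xM by (auto simp: memr[OF i] memX)
      also have "\<dots> \<longleftrightarrow> (\<exists>j\<in>J i. maps_to s (x j) z)"
        unfolding JB by simp
      also have "\<dots> \<longleftrightarrow> z \<in> \<sigma> ` J i"
        unfolding image_iff using J[OF i] \<sigma> z by (intro bex_cong refl) auto
      also have "z \<epsilon> r i \<and> z \<epsilon> A' \<longleftrightarrow> z \<in> (x ` J i \<union> B i) \<inter> A"
        by (simp add: memr[OF i z] memA[OF z])
      also have "(x ` J i \<union> B i) \<inter> A = B i" using J[OF i] B[OF i] disj by blast
      finally show ?thesis by blast
    qed
    moreover have "\<sigma> ` J i \<union> B i \<subseteq> M" using J[OF i] \<sigma>M BM by blast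
    ultimately show ?thesis unfolding ext_def by blast
  qed
  with \<sigma>M show ?thesis by blast
qed

text \<open>Every finite subset of \<open>M\<close> is coded, so for finite systems the coding
  conditions hold automatically.\<close>

lemma finite_flat_system_solution:
  fixes x :: "'i \<Rightarrow> 'a"
  assumes fin: "finite I" and "inj_on x I" and x: "x ` I \<subseteq> M"
    and A: "finite A" "A \<subseteq> M" and "x ` I \<inter> A = {}"
    and J: "\<And>i. i \<in> I \<Longrightarrow> J i \<subseteq> I" and B: "\<And>i. i \<in> I \<Longrightarrow> B i \<subseteq> A"
  shows "\<exists>\<sigma>. \<forall>i\<in>I. \<sigma> i \<in> M \<and> ext (\<sigma> i) = \<sigma> ` J i \<union> B i"
proof -
  define r where "r = (\<lambda>i. code (x ` J i \<union> B i))"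
  have r: "x ` J i \<union> B i \<in> ext ` M" if "i \<in> I" for i
  proof (rule finite_in_ext)
    show "finite (x ` J i \<union> B i)" using J[OF that] B[OF that] fin A(1) by (auto intro: finite_subset)
    show "x ` J i \<union> B i \<subseteq> M" using J[OF that] B[OF that] A(2) x by blast
  qed
  have rM: "r i \<in> M" if "i \<in> I" for i using r[OF that] by (simp add: r_def)
  show ?thesis
  proof (rule flat_system_solution[of x I A r J B])
    show "(\<lambda>i. opair (x i) (r i)) ` I \<in> ext ` M"
      using x rM by (intro finite_in_ext finite_imageI fin) auto
    show "x ` I \<in> ext ` M" "A \<in> ext ` M" using fin x A by (auto intro: finite_in_ext)
  qed (use assms(2,6-) r rM in \<open>simp_all add: r_def\<close>)
qed


section \<open>Numerals and the well-founded part\<close>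

text \<open>Well-foundedness is meant in the metatheory: a nonstandard numeral lies outside,
  although the model regards it as well-founded.\<close>

definition wf_part :: "'a set" where
  "wf_part = Wellfounded.acc {(u, x). u \<in> ext x}"

lemma wf_partI: "(\<And>u. u \<in> ext x \<Longrightarrow> u \<in> wf_part) \<Longrightarrow> x \<in> wf_part"
  unfolding wf_part_def by (rule accI) auto

lemma wf_partD: "x \<in> wf_part \<Longrightarrow> u \<in> ext x \<Longrightarrow> u \<in> wf_part"
  unfolding wf_part_def by (rule acc_downward) auto

text \<open>If \<open>x\<close> and \<open>y\<close> contain each other, then \<open>y\<close> is an
  element of \<open>x\<close> with the same property, against the induction hypothesis for
  \<open>y\<close>. Taking \<open>y = x\<close> also excludes loops.\<close>

lemma wf_part_no_double_edge:
  assumes "x \<in> wf_part" "y \<in> ext x" shows "x \<notin> ext y"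
proof -
  have "x \<in> Wellfounded.acc {(u, x). u \<in> ext x}" using assms(1) by (simp add: wf_part_def)
  then have "\<forall>y. y \<in> ext x \<longrightarrow> x \<notin> ext y"
    by (rule acc_induct) (metis (mono_tags, lifting) case_prodI mem_Collect_eq)
  with assms(2) show ?thesis by blast
qed

lemma wf_part_irrefl: "x \<in> wf_part \<Longrightarrow> x \<notin> ext x"
  using wf_part_no_double_edge[of x x] by blast

fun num :: "nat \<Rightarrow> 'a" where
  "num 0 = code {}"
| "num (Suc n) = code (insert (num n) (ext (num n)))"

lemma num_mem [simp]: "num n \<in> M"
  by (induction n) (simp_all add: empty_in_ext insert_in_ext)

lemma ext_num: "ext (num n) = num ` {..<n}"
proof (induction n)
  case (Suc n)
  have "insert (num n) (ext (num n)) \<in> ext ` M" by (intro insert_in_ext imageI num_mem)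
  then have "ext (num (Suc n)) = insert (num n) (ext (num n))" by simp
  with Suc show ?case by (simp add: lessThan_Suc)
qed (simp add: empty_in_ext)

lemma num_wf: "num n \<in> wf_part"
proof (induction n rule: less_induct)
  case (less n)
  show ?case by (rule wf_partI) (use less in \<open>auto simp: ext_num\<close>)
qed

lemma inj_num: "inj num"
proof (rule linorder_injI)
  fix m n :: nat assume "m < n"
  then have "num m \<in> ext (num n)" by (simp add: ext_num)
  \<comment> \<open>Equality would make a numeral an element of itself; in the absence of Foundation
    this is excluded by \<open>wf_part\<close>.\<close>
  then show "num m \<noteq> num n" using wf_part_irrefl num_wf by metis
qed

text \<open>Only an inclusion is claimed: the numerals are indexed by the external naturals, and
  \<open>range num\<close> need not be coded when the model has nonstandard numerals.\<close>

lemma inductive_set_numerals: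
  obtains w where "w \<in> M" "range num \<subseteq> ext w"
proof -
  obtain w e where w: "w \<in> M" "e \<in> M" "is_empty e" "e \<epsilon> w"
    "\<forall>x\<in>M. x \<epsilon> w \<longrightarrow> (\<exists>y\<in>M. is_successor y x \<and> y \<epsilon> w)"
    using infinity by blast
  have "num n \<epsilon> w" for n
  proof (induction n)
    case 0
    have "ext e = {}" using w by (auto simp: is_empty_def ext_def)
    then show ?case using w ext_eq_iff[OF _ empty_in_ext] by auto
  next
    case (Suc n)
    then obtain y where y: "y \<in> M" "is_successor y (num n)" "y \<epsilon> w" using w by auto
    then have "ext y = insert (num n) (ext (num n))"
      by (auto simp: is_successor_def ext_def)
    then have "y = num (Suc n)" using ext_eq_iff y(1) insert_in_ext by auto
    with y show ?case by simp
  qed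
  then have "range num \<subseteq> ext w" by (auto simp: ext_def)
  with w(1) show ?thesis by (rule that)
qed

end


section \<open>Instances of Replacement\<close>

definition disj_fm :: "fm \<Rightarrow> fm \<Rightarrow> fm" where
  "disj_fm p q = Neg (Conj (Neg p) (Neg q))"

definition iff_fm :: "fm \<Rightarrow> fm \<Rightarrow> fm" where
  "iff_fm p q = Conj (Neg (Conj p (Neg q))) (Neg (Conj q (Neg p)))"

definition ex_fm :: "nat \<Rightarrow> fm \<Rightarrow> fm" where
  "ex_fm i p = Neg (Forall i (Neg p))"

lemma sat_connectives [simp]:
  "sat M E v (disj_fm p q) \<longleftrightarrow> sat M E v p \<or> sat M E v q"
  "sat M E v (iff_fm p q) \<longleftrightarrow> (sat M E v p \<longleftrightarrow> sat M E v q)"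
  "sat M E v (ex_fm i p) \<longleftrightarrow> (\<exists>a\<in>M. sat M E (v(i := a)) p)"
  by (auto simp: disj_fm_def iff_fm_def ex_fm_def)

text \<open>Bound variables are chosen larger than the sum of the free ones, hence fresh.\<close>

definition upair_fm :: "nat \<Rightarrow> nat \<Rightarrow> nat \<Rightarrow> fm" where
  "upair_fm z x y = (let k = Suc (z + x + y) in
     Forall k (iff_fm (Mem k z) (disj_fm (Equal k x) (Equal k y))))"

definition opair_fm :: "nat \<Rightarrow> nat \<Rightarrow> nat \<Rightarrow> fm" where
  "opair_fm p x y = (let a = Suc (p + x + y); b = Suc a in
     ex_fm a (ex_fm b (Conj (upair_fm a x x) (Conj (upair_fm b x y) (upair_fm p a b)))))"

context set_structure
begin

lemma sat_upair_fm [simp]: "sat M (\<epsilon>) v (upair_fm z x y) \<longleftrightarrow> is_upair (v z) (v x) (v y)"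
  by (simp add: upair_fm_def is_upair_def Let_def)

lemma sat_opair_fm [simp]: "sat M (\<epsilon>) v (opair_fm p x y) \<longleftrightarrow> is_opair (v p) (v x) (v y)"
  by (simp add: opair_fm_def is_opair_def Let_def)

end

context zfa_model
begin

text \<open>Replacement in external terms: the image of a coded set under \<open>f\<close> is coded
  once a formula with parameters defines \<open>f\<close> on that set.\<close>

lemma image_in_ext:
  assumes w: "w \<in> M" and v: "range v \<subseteq> M" and f: "f ` ext w \<subseteq> M"
    and sat: "\<And>u y. u \<in> ext w \<Longrightarrow> y \<in> M \<Longrightarrow> sat M (\<epsilon>) (v(0 := u, 1 := y)) \<phi> \<longleftrightarrow> y = f u"
  shows "f ` ext w \<in> ext ` M"
proof -
  have sat': "sat M (\<epsilon>) (v(0 := u, 1 := y)) \<phi> \<longleftrightarrow> y = f u"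
    if "u \<in> M" "u \<epsilon> w" "y \<in> M" for u y
    using sat that by (simp add: ext_def)
  have functional: "y = y'" if "u \<in> M" "u \<epsilon> w" "y \<in> M" "y' \<in> M"
      "sat M (\<epsilon>) (v(0 := u, 1 := y)) \<phi> \<and> sat M (\<epsilon>) (v(0 := u, 1 := y')) \<phi>" for u y y'
    using that(5) unfolding sat'[OF that(1-3)] sat'[OF that(1,2,4)] by simp
  have "\<exists>z\<in>M. \<forall>y\<in>M. y \<epsilon> z \<longleftrightarrow>
      (\<exists>u\<in>M. u \<epsilon> w \<and> sat M (\<epsilon>) (v(0 := u, 1 := y)) \<phi>)"
    by (rule replacement[rule_format, OF v w]) (rule functional)
  then obtain z where z: "z \<in> M"
    "\<And>y. y \<in> M \<Longrightarrow> y \<epsilon> z \<longleftrightarrow> (\<exists>u\<in>M. u \<epsilon> w \<and> sat M (\<epsilon>) (v(0 := u, 1 := y)) \<phi>)"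
    by blast
  have "y \<epsilon> z \<longleftrightarrow> y \<in> f ` ext w" if "y \<in> M" for y
  proof -
    have "y \<epsilon> z \<longleftrightarrow> (\<exists>u\<in>M. u \<epsilon> w \<and> y = f u)"
      unfolding z(2)[OF that] by (intro bex_cong conj_cong refl sat' that)
    then show ?thesis by (auto simp: ext_def)
  qed
  then have "ext z = f ` ext w" using f by (auto simp: ext_def)
  with z(1) show ?thesis by blast
qed

lemma code_pairs_in_ext:
  assumes "w \<in> M" "t \<in> M"
  shows "(\<lambda>u. code {u, t}) ` ext w \<in> ext ` M"
proof (rule image_in_ext[OF assms(1)])
  fix u y assume "u \<in> ext w" "y \<in> M"
  moreover from this have "u \<in> M" using ext_subset by blast
  ultimately show "sat M (\<epsilon>) ((\<lambda>_. t)(0 := u, 1 := y)) (upair_fm 1 0 2) \<longleftrightarrow> y = code {u, t}"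
    using assms by (simp add: is_upair_iff)
next
  show "(\<lambda>u. code {u, t}) ` ext w \<subseteq> M"
    using assms ext_subset by (blast intro: code_pair_mem)
qed (use assms in simp)

lemma opairs_in_ext:
  assumes "w \<in> M" "t \<in> M" "c \<in> M"
  shows "(\<lambda>u. opair (code {u, t}) (code {c, u})) ` ext w \<in> ext ` M"
proof (rule image_in_ext[OF assms(1)])
  fix u y assume "u \<in> ext w" "y \<in> M"
  moreover from this have "u \<in> M" using ext_subset by blast
  \<comment> \<open>Variables 2 and 3 hold the parameters \<open>t\<close> and \<open>c\<close>; the
    bound variables 4 and 5 stand for the two unordered pairs.\<close>
  ultimately show "sat M (\<epsilon>) (((\<lambda>_. t)(3 := c))(0 := u, 1 := y)) (ex_fm 4 (ex_fm 5
      (Conj (upair_fm 4 0 2) (Conj (upair_fm 5 3 0) (opair_fm 1 4 5))))) \<longleftrightarrow>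
      y = opair (code {u, t}) (code {c, u})"
    using assms by (simp add: is_upair_iff is_opair_iff conj_ac cong: conj_cong)
next
  show "(\<lambda>u. opair (code {u, t}) (code {c, u})) ` ext w \<subseteq> M"
    using assms ext_subset by (blast intro: code_pair_mem opair_mem)
  show "range ((\<lambda>_. t)(3 := c)) \<subseteq> M"
    using assms by auto
qed


section \<open>Components of the double-edge graph\<close>

abbreviation D :: "'a rel" where "D \<equiv> double_edges M (\<epsilon>)"

lemma double_edges_iff: "(x, y) \<in> D \<longleftrightarrow> x \<in> ext y \<and> y \<in> ext x"
  by (auto simp: double_edges_def ext_def)

lemma infinite_component: "\<exists>C \<in> components M D. infinite C"
proof -
  obtain w where w: "w \<in> M" "range num \<subseteq> ext w" by (rule inductive_set_numerals)
  \<comment> \<open>As no element of \<open>w\<close> contains \<open>t\<close>, the pairs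
    \<open>{u, t}\<close> lie outside \<open>w\<close> and can serve as indeterminates for the
    leaves, with \<open>w\<close> as the set of atoms.\<close>
  obtain t where t: "t \<in> M" "t \<notin> (\<Union>y\<in>ext w. ext y)"
    using ex_not_in_ext[OF code_mem[OF Union_in_ext[OF w(1)]]] Union_in_ext[OF w(1)] by auto
  define Y where "Y = (\<lambda>u. code {u, t}) ` ext w"
  have Y: "Y \<in> ext ` M" unfolding Y_def using code_pairs_in_ext w t by blast
  then have "ext w \<union> Y \<in> ext ` M" using Un_in_ext w(1) by blast
  then obtain d where d: "d \<in> M" "ext d = ext w \<union> Y" by force
  then obtain c where c: "c \<in> M" "c \<notin> ext w" "c \<notin> Y" using ex_not_in_ext by blast
  \<comment> \<open>\<open>None\<close> indexes the centre, with indeterminate \<open>c\<close> and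
    right-hand side \<open>Y\<close>; \<open>Some u\<close> indexes the leaf whose right-hand side
    is \<open>{c, u}\<close>.\<close>
  define I where "I = insert None (Some ` ext w)"
  define x where "x = case_option c (\<lambda>u. code {u, t})"
  define r where "r = case_option (code Y) (\<lambda>u. code {c, u})"
  define J :: "'a option \<Rightarrow> 'a option set" where "J = case_option (Some ` ext w) (\<lambda>_. {None})"
  define B :: "'a option \<Rightarrow> 'a set" where "B = case_option {} (\<lambda>u. {u})"
  have wM: "u \<in> M" if "u \<in> ext w" for u using that ext_subset by blast
  have x_None: "x None = c" and xw: "x ` Some ` ext w = Y"
    by (simp_all add: x_def Y_def image_image)
  then have xI: "x ` I = insert c Y" by (simp add: I_def)
  have Yw: "Y \<inter> ext w = {}"
  proof -
    have "code {u, t} \<notin> ext w" if "u \<in> ext w" for u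
      using t pair_in_ext[OF wM[OF that] t(1)] by force
    then show ?thesis by (auto simp: Y_def)
  qed
  have "\<exists>\<sigma>. \<forall>i\<in>I. \<sigma> i \<in> M \<and> ext (\<sigma> i) = \<sigma> ` J i \<union> B i"
  proof (rule flat_system_solution[of x I "ext w" r J B])
    show "x ` I \<in> ext ` M" using insert_in_ext c Y xI by simp
    show "ext w \<in> ext ` M" using w by blast
    have "(\<lambda>i. opair (x i) (r i)) ` I =
        insert (opair c (code Y)) ((\<lambda>u. opair (code {u, t}) (code {c, u})) ` ext w)"
      by (auto simp: I_def x_def r_def image_image)
    then show "(\<lambda>i. opair (x i) (r i)) ` I \<in> ext ` M"
      using insert_in_ext opairs_in_ext w t c Y by simp
    have "inj_on (\<lambda>u. code {u, t}) (ext w)"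
      by (intro inj_onI) (use t wM in \<open>auto simp: code_pair_eq_iff doubleton_eq_iff\<close>)
    then have "inj_on x (Some ` ext w)" by (simp add: inj_on_def x_def)
    moreover have "Some ` ext w - {None} = Some ` ext w" by auto
    ultimately show "inj_on x I" unfolding I_def inj_on_insert x_None using c(3) xw by argo
    show "x ` I \<inter> ext w = {}" using xI c Yw by auto
    have r_None: "r None \<in> M" "ext (r None) = x ` J None \<union> B None"
      using Y by (simp_all add: r_def J_def B_def xw)
    have r_Some: "r (Some u) \<in> M" "ext (r (Some u)) = x ` J (Some u) \<union> B (Some u)"
      if "u \<in> ext w" for u
      using c(1) wM[OF that] by (auto simp: r_def J_def B_def x_None pair_in_ext)
    show "r i \<in> M" "ext (r i) = x ` J i \<union> B i" if "i \<in> I" for i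
      using that r_None r_Some unfolding I_def by blast+
  qed (auto simp: I_def J_def B_def)
  then obtain \<sigma> where \<sigma>: "\<And>i. i \<in> I \<Longrightarrow> \<sigma> i \<in> M" "\<And>i. i \<in> I \<Longrightarrow> ext (\<sigma> i) = \<sigma> ` J i \<union> B i"
    by blast
  define a where "a = \<sigma> None"
  \<comment> \<open>Only leaves over numerals are followed: numerals are well-founded and the centre
    is not, so \<open>{a, num n}\<close> determines \<open>num n\<close>. An arbitrary element of
    \<open>w\<close> might equal the centre.\<close>
  define l where "l = (\<lambda>n. \<sigma> (Some (num n)))"
  have numw: "num n \<in> ext w" for n using w(2) by blast
  have a: "a \<in> M" "l n \<in> ext a" for n
    using \<sigma>[of None] numw by (auto simp: a_def l_def I_def J_def B_def)
  have l: "l n \<in> M" "ext (l n) = {a, num n}" for n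
    using \<sigma>[of "Some (num n)"] numw by (auto simp: a_def l_def I_def J_def B_def)
  have edge: "(a, l n) \<in> D" for n using a l by (simp add: double_edges_iff)
  have "a \<in> ext (l 0)" by (simp add: l(2))
  then have "a \<notin> wf_part" using wf_part_no_double_edge[OF _ a(2)[of 0]] by blast
  then have num_a: "num n \<noteq> a" for n using num_wf by blast
  have "inj l"
  proof (rule injI)
    fix m n assume "l m = l n"
    then have "{a, num m} = {a, num n}" using l(2) by metis
    then have "num m = num n" using num_a[of m] num_a[of n] by (simp add: doubleton_eq_iff)
    then show "m = n" using inj_num by (simp add: inj_eq)
  qed
  then have "infinite (range l)" by (rule range_inj_infinite)
  moreover have "range l \<subseteq> Restr (D\<^sup>*) M `` {a}"
    using r_into_rtrancl[OF edge] a(1) l(1) by blast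
  ultimately have "infinite (Restr (D\<^sup>*) M `` {a})" by (rule infinite_super[rotated])
  moreover have "Restr (D\<^sup>*) M `` {a} \<in> components M D"
    unfolding components_def using a by (intro quotientI)
  ultimately show ?thesis by blast
qed

section \<open>Components isomorphic to a given finite graph\<close>

lemma componentsI:
  assumes "C \<noteq> {}" "C \<subseteq> M" and closed: "\<And>x y. x \<in> C \<Longrightarrow> (x, y) \<in> D \<Longrightarrow> y \<in> C"
    and conn: "\<And>x y. x \<in> C \<Longrightarrow> y \<in> C \<Longrightarrow> (x, y) \<in> D\<^sup>*"
  shows "C \<in> components M D"
proof -
  obtain x where x: "x \<in> C" using assms(1) by blast
  have reach: "y \<in> C" if "(x, y) \<in> D\<^sup>*" for y
    using that
  proof induction
    case base show ?case by (rule x)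
  next
    case (step y z) then show ?case using closed by blast
  qed
  have "(x, y) \<in> Restr (D\<^sup>*) M \<longleftrightarrow> y \<in> C" for y
    using reach[of y] conn[OF x, of y] x assms(2) by blast
  then have "Restr (D\<^sup>*) M `` {x} = C" unfolding Image_singleton by simp
  moreover have "Restr (D\<^sup>*) M `` {x} \<in> components M D"
    unfolding components_def using x assms(2) by (intro quotientI) blast
  ultimately show ?thesis by simp
qed

lemma graph_isomorphic_image:
  assumes "inj_on \<sigma> V" "\<And>i j. i \<in> V \<Longrightarrow> j \<in> V \<Longrightarrow> (\<sigma> i, \<sigma> j) \<in> S \<longleftrightarrow> (i, j) \<in> R"
  shows "graph_isomorphic (\<sigma> ` V) (Restr S (\<sigma> ` V)) V R"
  unfolding graph_isomorphic_def
proof (intro exI conjI)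
  \<comment> \<open>The isomorphism must go from the copy to the graph, hence the inverse of
    \<open>\<sigma>\<close>.\<close>
  show "bij_betw (inv_into V \<sigma>) (\<sigma> ` V) V"
    using assms(1) by (simp add: inj_on_imp_bij_betw bij_betw_inv_into)
  show "\<forall>x\<in>\<sigma> ` V. \<forall>y\<in>\<sigma> ` V. (x, y) \<in> Restr S (\<sigma> ` V) \<longleftrightarrow>
      (inv_into V \<sigma> x, inv_into V \<sigma> y) \<in> R"
    using assms by simp
qed

text \<open>The assumption \<open>nbr\<close> places every vertex of a copy on a double edge,
  possibly a loop; this makes the vertices ill-founded and so distinguishable from their markers
  \<open>b k i\<close>.\<close>

lemma infinite_graph_copies:
  fixes V :: "'b set"
  assumes R: "R \<subseteq> V \<times> V" "sym R" and fin: "finite V" and conn: "connected_graph V R"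
    and nbr: "\<And>i. i \<in> V \<Longrightarrow> \<exists>j. (i, j) \<in> R"
  shows "infinite {C \<in> components M D. graph_isomorphic C (Restr D C) V R}"
proof -
  obtain h where h: "bij_betw h V {0..<card V}" using ex_bij_betw_finite_nat[OF fin] by blast
  \<comment> \<open>Markers for copy \<open>k\<close> come from the block of numerals with quotient
    \<open>Suc k\<close> by \<open>card V\<close>. The successor reserves the first block for the
    indeterminates \<open>num (h i)\<close>.\<close>
  define b where "b = (\<lambda>k i. num (card V * Suc k + h i))"
  have hlt: "h i < card V" if "i \<in> V" for i using h that by (auto simp: bij_betw_def)
  have b_eq: "k = k' \<and> i = i'" if "b k i = b k' i'" "i \<in> V" "i' \<in> V" for k i k' i'
  proof -
    have eq: "card V * Suc k + h i = card V * Suc k' + h i'"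
      using that(1) inj_num by (simp add: b_def inj_eq)
    have "(card V * Suc k + h i) div card V = Suc k" "(card V * Suc k' + h i') div card V = Suc k'"
      "(card V * Suc k + h i) mod card V = h i" "(card V * Suc k' + h i') mod card V = h i'"
      using hlt[OF that(2)] hlt[OF that(3)] by (simp_all del: mult_Suc_right)
    with eq have "Suc k = Suc k'" "h i = h i'" by metis+
    then show ?thesis using h that by (auto simp: bij_betw_def inj_on_def)
  qed
  have "\<exists>\<sigma>. \<forall>i\<in>V. \<sigma> i \<in> M \<and> ext (\<sigma> i) = \<sigma> ` (R `` {i}) \<union> {b k i}" for k
  proof (rule finite_flat_system_solution[of V "num \<circ> h" "b k ` V" "\<lambda>i. R `` {i}" "\<lambda>i. {b k i}"])
    show "inj_on (num \<circ> h) V" using h inj_num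
      by (auto simp: bij_betw_def intro: comp_inj_on inj_on_subset)
    have "num (h i) \<noteq> b k j" if "i \<in> V" for i j
      using hlt[OF that] inj_num by (auto simp: b_def inj_eq)
    then show "(num \<circ> h) ` V \<inter> b k ` V = {}" by fastforce
  qed (use fin R in \<open>auto simp: b_def\<close>)
  then obtain \<sigma> where \<sigma>: "\<And>k i. i \<in> V \<Longrightarrow> \<sigma> k i \<in> M"
      "\<And>k i. i \<in> V \<Longrightarrow> ext (\<sigma> k i) = \<sigma> k ` (R `` {i}) \<union> {b k i}"
    by metis
  have not_wf: "\<sigma> k i \<notin> wf_part" if "i \<in> V" for k i
  proof -
    obtain j where j: "(i, j) \<in> R" using nbr \<open>i \<in> V\<close> by blast
    then have "(j, i) \<in> R" "j \<in> V" using R by (auto dest: symD)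
    with j that have "\<sigma> k j \<in> ext (\<sigma> k i)" "\<sigma> k i \<in> ext (\<sigma> k j)" using \<sigma>(2) by auto
    then show ?thesis using wf_part_no_double_edge by blast
  qed
  have b_wf: "b k i \<in> wf_part" for k i by (simp add: b_def num_wf)
  \<comment> \<open>The marker can be read off from the set, so both the vertex and the copy are
    determined by it.\<close>
  have ext_wf: "ext (\<sigma> k i) \<inter> wf_part = {b k i}" if "i \<in> V" for k i
    using \<sigma>(2)[OF that] b_wf not_wf R by auto
  have \<sigma>_eq: "k = k' \<and> i = i'" if "\<sigma> k i = \<sigma> k' i'" "i \<in> V" "i' \<in> V" for k i k' i'
    using b_eq that ext_wf by (metis singleton_inject)
  have inj: "inj_on (\<sigma> k) V" for k using \<sigma>_eq by (auto simp: inj_on_def)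
  have edge: "(\<sigma> k i, y) \<in> D \<longleftrightarrow> (\<exists>j. y = \<sigma> k j \<and> (i, j) \<in> R)" if i: "i \<in> V" for k i y
  proof
    assume "(\<sigma> k i, y) \<in> D"
    then have y: "\<sigma> k i \<in> ext y" "y \<in> ext (\<sigma> k i)" by (auto simp: double_edges_iff)
    \<comment> \<open>Elements of a well-founded set are well-founded, so the marker cannot contain
      \<open>\<sigma> k i\<close> and adds no double edge.\<close>
    have "y \<noteq> b k i" using y(1) b_wf not_wf[OF i] wf_partD by blast
    then show "\<exists>j. y = \<sigma> k j \<and> (i, j) \<in> R" using y(2) \<sigma>(2)[OF i] by auto
  next
    assume "\<exists>j. y = \<sigma> k j \<and> (i, j) \<in> R"
    then obtain j where j: "y = \<sigma> k j" "(i, j) \<in> R" by blast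
    then have "(j, i) \<in> R" "j \<in> V" using R by (auto dest: symD)
    with i j show "(\<sigma> k i, y) \<in> D" using \<sigma>(2) by (auto simp: double_edges_iff)
  qed
  have "\<sigma> k ` V \<in> {C \<in> components M D. graph_isomorphic C (Restr D C) V R}" for k
  proof (intro CollectI conjI componentsI graph_isomorphic_image inj)
    show "\<sigma> k ` V \<noteq> {}" using conn by (simp add: connected_graph_def)
    show "\<sigma> k ` V \<subseteq> M" using \<sigma>(1) by blast
    show "(\<sigma> k i, \<sigma> k j) \<in> D \<longleftrightarrow> (i, j) \<in> R" if "i \<in> V" "j \<in> V" for i j
      using edge[OF that(1)] R(1) \<sigma>_eq that by blast
    show "y \<in> \<sigma> k ` V" if "x \<in> \<sigma> k ` V" "(x, y) \<in> D" for x y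
      using that edge R(1) by blast
    fix x y assume "x \<in> \<sigma> k ` V" "y \<in> \<sigma> k ` V"
    then obtain i j where ij: "x = \<sigma> k i" "y = \<sigma> k j" "i \<in> V" "j \<in> V" by blast
    then have "(i, j) \<in> R\<^sup>*" using conn by (simp add: connected_graph_def)
    then have "(\<sigma> k i, \<sigma> k j) \<in> D\<^sup>*"
    proof induction
      case (step p q)
      then have "(\<sigma> k p, \<sigma> k q) \<in> D" using edge R(1) by blast
      with step show ?case by (meson rtrancl.rtrancl_into_rtrancl)
    qed simp
    with ij show "(x, y) \<in> D\<^sup>*" by simp
  qed
  \<comment> \<open>Distinct copies share no vertex, and \<open>V\<close> is nonempty, so their
    vertex sets differ.\<close>
  moreover have "inj (\<lambda>k. \<sigma> k ` V)"
  proof (rule injI)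
    fix k k' assume eq: "\<sigma> k ` V = \<sigma> k' ` V"
    obtain i where i: "i \<in> V" using conn by (auto simp: connected_graph_def)
    then obtain j where "j \<in> V" "\<sigma> k i = \<sigma> k' j" using eq by blast
    with i \<sigma>_eq show "k = k'" by blast
  qed
  ultimately show ?thesis
    by (meson finite_subset image_subsetI range_inj_infinite)
qed

text \<open>Numerals are well-founded, so each is on no double edge and forms a component by
  itself.\<close>

lemma infinite_isolated_vertices:
  "infinite {C \<in> components M D. graph_isomorphic C (Restr D C) {v} {}}"
proof -
  have iso: "(num k, y) \<notin> D" for k y
    using wf_part_no_double_edge[OF num_wf] by (auto simp: double_edges_iff)
  have "{num k} \<in> {C \<in> components M D. graph_isomorphic C (Restr D C) {v} {}}" for k
    using componentsI[of "{num k}"] graph_isomorphic_image[of "\<lambda>_. num k" "{v}" D "{}"] iso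
    by auto
  moreover have "inj (\<lambda>k. {num k})" using inj_num by (simp add: inj_def)
  ultimately show ?thesis
    by (meson finite_subset image_subsetI range_inj_infinite)
qed

lemma infinite_components:
  fixes V :: "'b set"
  assumes "loopy_graph V R" "finite V" "connected_graph V R"
  shows "infinite {C \<in> components M D. graph_isomorphic C (Restr D C) V R}"
proof (cases "R = {}")
  case True
  \<comment> \<open>Without edges the reflexive transitive closure is the identity, so connectedness
    leaves a single vertex.\<close>
  then obtain v where "V = {v}" using assms(3) by (auto simp: connected_graph_def)
  with True show ?thesis using infinite_isolated_vertices by simp
next
  case False
  then obtain p q where pq: "(p, q) \<in> R" by auto
  have "\<exists>j. (i, j) \<in> R" if "i \<in> V" for i
  proof -
    have "(i, p) \<in> R\<^sup>*"
      using assms(1,3) pq that by (auto simp: connected_graph_def loopy_graph_def)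
    \<comment> \<open>Either a path from \<open>i\<close> to \<open>p\<close> begins with an edge at
      \<open>i\<close>, or \<open>i = p\<close> and \<open>q\<close> is the neighbour.\<close>
    then show ?thesis using pq by (cases rule: converse_rtranclE) auto
  qed
  then show ?thesis using infinite_graph_copies assms by (auto simp: loopy_graph_def)
qed

end

theorem theorem4:
  fixes M :: "'a set" and E :: "'a \<Rightarrow> 'a \<Rightarrow> bool"
  assumes "countable M" and "zfa_model M E"
  shows "(\<forall>(V :: 'b set) R.
            loopy_graph V R \<and> finite V \<and> connected_graph V R \<longrightarrow>
            infinite {C \<in> components M (double_edges M E).
                        graph_isomorphic C (Restr (double_edges M E) C) V R})
       \<and> (\<exists>C \<in> components M (double_edges M E). infinite C)"
proof -
  interpret zfa_model M E by fact
  show ?thesis using infinite_components infinite_component by blast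
qed

end
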